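(* (Error behavior of recursive summation with 6op compensation.) Let $n\ge1$, $x_1,\dots,x_n\in\mathbb D$, $\tilde s=\sum_{k=1}^n x_k$ (exact sum in $\mathbb R$). Set $s_0=e_0=0$ and for $i=1,\dots,n$ let $$y_i=fl(e_{i-1}+x_i),\qquad (s_i,e_i)=\mathrm{add6}(s_{i-1},y_i).$$ Assume nearest rounding and that no overflow happens. Then there exist real numbers $\alpha_i,\beta_i$ with $|\alpha_i|,|\beta_i|\le\epsilon$ such that, for $i=1,\dots,n$, $$y_i=(1+\alpha_i)(e_{i-1}+x_i),\quad s_i=(1+\beta_i)(s_{i-1}+y_i),\quad e_i=-\beta_i(s_{i-1}+y_i),$$ $$s_i+e_i=(1-\alpha_i\beta_{i-1})(s_{i-1}+e_{i-1})+(1+\alpha_i)x_i$$ (where $\beta_0:=0$; its value is irrelevant since $s_0+e_0=0$), and $$s_n+e_n=\sum_{k=1}^n\Big\{\prod_{i=k+1}^n(1-\alpha_i\beta_{i-1})\Big\}(1+\alpha_k)x_k ,$$ with the empty product equal to $1$. If moreover $n\epsilon^2<1$, then $$|s_n+e_n-\tilde s|\le\epsilon\sum_{k=1}^n|x_k|+\sum_{k=1}^n\frac{(n-k)\epsilon^2}{1-(n-k)\epsilon^2}|x_k|+\sum_{k=1}^n\frac{(n-k)\epsilon^3}{1-(n-k)\epsilon^2}|x_k|$$ $$\le\epsilon\sum_{k=1}^n|x_k|+\frac{(n-1)\epsilon^2}{1-(n-1)\epsilon^2}\sum_{k=1}^n|x_k|+\frac{(n-1)\epsilon^3}{1-(n-1)\epsilon^2}\sum_{k=1}^n|x_k|,$$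 and $$|s_n-\tilde s|\le(1+\epsilon)\Big\{\epsilon\sum_{k=1}^n|x_k|+\frac{(n-1)\epsilon^2}{1-(n-1)\epsilon^2}\sum_{k=1}^n|x_k|+\frac{(n-1)\epsilon^3}{1-(n-1)\epsilon^2}\sum_{k=1}^n|x_k|\Big\}+\epsilon\Big|\sum_{k=1}^n x_k\Big|.$$
   Context: Dekker's floating point number system in base $2$: let $t\ge 1$, $E_{\min}\le E_{\max}$ be integers and $M=2^t$. Then $\mathbb D=\{x\in\mathbb R : x=m\times2^{e},\ m,e\in\mathbb Z,\ |m|<M,\ E_{\min}\le e\le E_{\max}\}$. Nearest rounding $fl:\mathbb R\to\mathbb D$ satisfies $|fl(r)-r|\le|a-r|$ for all $a\in\mathbb D$, with ties resolved by a fixed deterministic criterion. Each floating point operation is performed as if the exact real result is produced and then rounded by $fl$. Unit round-off: $\epsilon=\tfrac12\cdot2^{1-t}=2^{-t}$. "No overflow" means that for every floating point operation performed in the algorithm (including those inside $\mathrm{add6}$), the exact real result before rounding has absolute value at most $(M-1)\times2^{E_{\max}}$. The procedure $\mathrm{add6}(x,y)$ returns $(z,zz)$ computed by $z=fl(x+y)$, $w=fl(z-x)$, $z1=fl(y-w)$, $v=fl(w-z)$, $z2=fl(x+v)$, $zz=fl(z1+z2)$. The perturbations $\alpha_i,\beta_i$ are real numbers (the symbol $\beta_i$ is unrelated to the base). *)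

theory Defs
  imports Complex_Main
begin

definition dekker_floats :: "nat \<Rightarrow> int \<Rightarrow> int \<Rightarrow> real set" where
  "dekker_floats t Emin Emax =
     {x. \<exists>m e :: int. x = of_int m * 2 powi e \<and> \<bar>m\<bar> < 2 ^ t \<and> Emin \<le> e \<and> e \<le> Emax}"

text \<open>Since \<open>fl\<close> is a function, ties are resolved deterministically; no particular
  tie-breaking rule is imposed.\<close>

definition nearest_rounding :: "real set \<Rightarrow> (real \<Rightarrow> real) \<Rightarrow> bool" where
  "nearest_rounding D fl \<longleftrightarrow> (\<forall>r. fl r \<in> D \<and> (\<forall>a\<in>D. \<bar>fl r - r\<bar> \<le> \<bar>a - r\<bar>))"

definition unit_roundoff :: "nat \<Rightarrow> real" where
  "unit_roundoff t = 1 / 2 * 2 powi (1 - int t)"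

definition add6 :: "(real \<Rightarrow> real) \<Rightarrow> real \<Rightarrow> real \<Rightarrow> real \<times> real" where
  "add6 fl x y =
     (let z = fl (x + y);
          w = fl (z - x);
          z1 = fl (y - w);
          v = fl (w - z);
          z2 = fl (x + v);
          zz = fl (z1 + z2)
      in (z, zz))"

text \<open>The exact results, before rounding, of the six operations performed by \<open>add6 fl x y\<close>.\<close>

definition add6_exact_results :: "(real \<Rightarrow> real) \<Rightarrow> real \<Rightarrow> real \<Rightarrow> real set" where
  "add6_exact_results fl x y =
     (let z = fl (x + y);
          w = fl (z - x);
          z1 = fl (y - w);
          v = fl (w - z);
          z2 = fl (x + v)
      in {x + y, z - x, y - w, w - z, x + v, z1 + z2})"

definition no_overflow :: "nat \<Rightarrow> int \<Rightarrow> real \<Rightarrow> bool" where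
  "no_overflow t Emax r \<longleftrightarrow> \<bar>r\<bar> \<le> (2 ^ t - 1) * 2 powi Emax"

end

theory Submission
  imports Defs
begin

text \<open>
  The heart of the matter is that the six-operation summation \<open>add6\<close> is error-free. Write
  \<open>w = fl (z - x)\<close>. If \<open>z - x\<close> is a float (in particular if \<open>\<bar>y\<bar> \<le> \<bar>x\<bar>\<close>), then
  \<open>z1 = x + y - z\<close> and \<open>z2 = 0\<close>. Otherwise \<open>\<bar>x\<bar> \<le> \<bar>z\<bar>\<close>, since \<open>\<bar>z\<bar> < \<bar>x\<bar> < \<bar>y\<bar>\<close> would make \<open>x + y\<close>
  a float; hence \<open>w - z\<close> and the error \<open>z - x - w\<close> are floats. Finally \<open>z - x = y + \<delta>\<close>, where the
  rounding error \<open>\<delta>\<close> of \<open>x + y\<close> is a float with \<open>\<bar>\<delta>\<bar> \<le> \<bar>x\<bar> < \<bar>y\<bar>\<close>, so \<open>w - y\<close> is a float as well, being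
  a rounded sum minus its larger summand.

  Consequently \<open>s\<^sub>i + e\<^sub>i = s\<^bsub>i-1\<^esub> + y\<^sub>i\<close> exactly, so \<open>e\<^sub>i = - \<beta>\<^sub>i (s\<^sub>i + e\<^sub>i)\<close>, and \<open>s\<^sub>i + e\<^sub>i\<close> satisfies
  a linear recurrence whose coefficients differ from 1 only to second order in \<open>\<epsilon>\<close>.
\<close>

section \<open>Dyadic grids and the floats on them\<close>

locale dekker_rounding =
  fixes t :: nat and Emin Emax :: int and fl :: "real \<Rightarrow> real"
  assumes t_ge_1: "t \<ge> 1"
    and nearest: "nearest_rounding (dekker_floats t Emin Emax) fl"
begin

abbreviation "D \<equiv> dekker_floats t Emin Emax"

text \<open>Every real of the form \<open>k * 2 powi h\<close> counts, however many digits \<open>k\<close> has.\<close>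

definition on_grid :: "int \<Rightarrow> real \<Rightarrow> bool" where
  "on_grid h r \<longleftrightarrow> (\<exists>k::int. r = of_int k * 2 powi h)"

lemma fl_in [simp, intro]: "fl r \<in> D"
  and fl_nearest: "a \<in> D \<Longrightarrow> \<bar>fl r - r\<bar> \<le> \<bar>a - r\<bar>"
  using nearest by (auto simp: nearest_rounding_def)

lemma on_grid_finer:
  assumes "on_grid h r" "g \<le> h"
  shows "on_grid g r"
proof -
  obtain k :: int where k: "r = of_int k * 2 powi h"
    using assms by (auto simp: on_grid_def)
  have "(2::real) powi h = 2 powi (int (nat (h - g))) * 2 powi g"
    using assms by (subst power_int_add [symmetric]) auto
  hence "r = of_int (k * 2 ^ nat (h - g)) * 2 powi g"
    unfolding k power_int_of_nat by simp
  thus ?thesis unfolding on_grid_def by blast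
qed

lemma on_grid_add: "on_grid h a \<Longrightarrow> on_grid h b \<Longrightarrow> on_grid h (a + b)"
  and on_grid_diff: "on_grid h a \<Longrightarrow> on_grid h b \<Longrightarrow> on_grid h (a - b)"
  unfolding on_grid_def
  by (metis distrib_right of_int_add, metis left_diff_distrib of_int_diff)

lemma floats_cases:
  assumes "a \<in> D"
  obtains h where "on_grid h a" "\<bar>a\<bar> < 2 ^ t * 2 powi h" "Emin \<le> h" "h \<le> Emax"
proof -
  obtain m h :: int where *: "a = of_int m * 2 powi h" "\<bar>m\<bar> < 2 ^ t" "Emin \<le> h" "h \<le> Emax"
    using assms by (auto simp: dekker_floats_def)
  have "\<bar>real_of_int m\<bar> < 2 ^ t"
    using *(2) by (metis of_int_abs of_int_less_iff of_int_numeral of_int_power)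
  hence "\<bar>a\<bar> < 2 ^ t * 2 powi h"
    by (simp add: *(1) abs_mult)
  with * that show ?thesis by (auto simp: on_grid_def)
qed

lemma floatsI:
  assumes "on_grid h a" "\<bar>a\<bar> < 2 ^ t * 2 powi h" "Emin \<le> h" "h \<le> Emax"
  shows "a \<in> D"
proof -
  obtain k :: int where k: "a = of_int k * 2 powi h"
    using assms by (auto simp: on_grid_def)
  have "\<bar>real_of_int k\<bar> < 2 ^ t"
    using assms(2) by (simp add: k abs_mult)
  hence "\<bar>k\<bar> < 2 ^ t"
    by (metis of_int_abs of_int_less_iff of_int_numeral of_int_power)
  with k assms show ?thesis by (auto simp: dekker_floats_def)
qed

lemma floats_uminus [simp]: "- a \<in> D \<longleftrightarrow> a \<in> D"
proof -
  have "- a \<in> D" if "a \<in> D" for a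
  proof -
    obtain m h :: int where *: "a = of_int m * 2 powi h" "\<bar>m\<bar> < 2 ^ t" "Emin \<le> h" "h \<le> Emax"
      using \<open>a \<in> D\<close> by (auto simp: dekker_floats_def)
    hence "- a = of_int (- m) * 2 powi h \<and> \<bar>- m\<bar> < 2 ^ t \<and> Emin \<le> h \<and> h \<le> Emax"
      by simp
    thus ?thesis unfolding dekker_floats_def by blast
  qed
  from this [of a] this [of "- a"] show ?thesis by auto
qed

lemma zero_in_floats: "a \<in> D \<Longrightarrow> 0 \<in> D"
  by (elim floats_cases) (auto intro!: floatsI exI [of _ 0] simp: on_grid_def)

lemma floats_minus_commute: "a - b \<in> D \<longleftrightarrow> b - a \<in> D"
  using floats_uminus [of "a - b"] by simp

text \<open>The significand \<open>2 ^ t\<close> is too large at exponent \<open>h\<close>, but \<open>2 ^ (t - 1)\<close> at exponent \<open>h + 1\<close> is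
  admissible.\<close>

lemma boundary_float:
  assumes "Emin \<le> h" "h < Emax"
  shows "2 ^ t * 2 powi h \<in> D"
proof -
  have pw: "(2::real) powi (h + 1) = 2 * 2 powi h"
    by (simp add: power_int_add)
  have tt: "(2::real) ^ t = 2 ^ (t - 1) * 2"
    using t_ge_1 by (cases t) auto
  show ?thesis
    unfolding dekker_floats_def
  proof (intro CollectI exI conjI)
    show "2 ^ t * 2 powi h = real_of_int (2 ^ (t - 1)) * 2 powi (h + 1)"
      by (simp add: pw tt)
    show "\<bar>2 ^ (t - 1) :: int\<bar> < 2 ^ t" using t_ge_1 by simp
  qed (use assms in auto)
qed

lemma floatsI_le:
  assumes "on_grid h a" "\<bar>a\<bar> \<le> 2 ^ t * 2 powi h" "Emin \<le> h" "h < Emax"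
  shows "a \<in> D"
proof (cases "\<bar>a\<bar> < 2 ^ t * 2 powi h")
  case True
  thus ?thesis using assms floatsI by auto
next
  case False
  hence "a = 2 ^ t * 2 powi h \<or> a = - (2 ^ t * 2 powi h)" using assms(2) by linarith
  thus ?thesis using boundary_float [OF assms(3,4)] by auto
qed

section \<open>Rounding and its effect on grids\<close>

lemma fl_eq: "a \<in> D \<Longrightarrow> fl a = a"
  using fl_nearest [of a a] by simp

text \<open>Both \<open>a\<close> and \<open>- a\<close> compete with \<open>fl r\<close>, so
  rounding cannot carry \<open>r\<close> into the interior of the interval between them.\<close>

lemma abs_le_abs_fl:
  assumes "a \<in> D" "\<bar>a\<bar> \<le> \<bar>r\<bar>"
  shows "\<bar>a\<bar> \<le> \<bar>fl r\<bar>"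
  using fl_nearest [of a r] fl_nearest [of "- a" r] assms by auto

text \<open>If \<open>r\<close> is too large for a float at exponent \<open>h\<close>, its size is
  at least \<open>2 ^ t * 2 powi g\<close>. For \<open>g < Emax\<close> that number is a float, so
  \<open>fl r\<close> could not fall below it, against the bound on \<open>fl r\<close>. For
  \<open>g = Emax\<close> also \<open>h = Emax\<close>, and absence of overflow bounds
  \<open>r\<close>.\<close>

lemma fl_exact_if_finer:
  assumes r: "on_grid h r" "Emin \<le> h" "h \<le> Emax"
    and g: "\<bar>fl r\<bar> < 2 ^ t * 2 powi g" "Emin \<le> g" "g \<le> h"
    and ovf: "g < Emax \<or> no_overflow t Emax r"
  shows "fl r = r"
proof (cases "\<bar>r\<bar> < 2 ^ t * 2 powi h")
  case True
  thus ?thesis using r floatsI fl_eq by auto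
next
  case False
  have le: "2 ^ t * 2 powi g \<le> (2 ^ t * 2 powi h :: real)"
    using g by (intro mult_left_mono power_int_increasing) auto
  show ?thesis
  proof (cases "g < Emax")
    case True
    from boundary_float [OF g(2) True] have "2 ^ t * 2 powi g \<le> \<bar>fl r\<bar>"
      using abs_le_abs_fl [of "2 ^ t * 2 powi g" r] False le by (simp add: abs_mult)
    with g show ?thesis by simp
  next
    case nl: False
    hence "g = Emax" "h = Emax" using g r by auto
    with nl ovf have "\<bar>r\<bar> \<le> (2 ^ t - 1) * 2 powi Emax" by (auto simp: no_overflow_def)
    also have "\<dots> < 2 ^ t * 2 powi Emax" by simp
    finally show ?thesis using False \<open>h = Emax\<close> by simp
  qed
qed

text \<open>A rounded value whose exponent is at least \<open>h\<close> lies on grid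
  \<open>h\<close> anyway; one whose exponent is below \<open>h\<close> must be exact.\<close>

lemma on_grid_fl:
  assumes "on_grid h r" "Emin \<le> h" "h \<le> Emax"
  shows "on_grid h (fl r)"
proof -
  obtain g where g: "on_grid g (fl r)" "\<bar>fl r\<bar> < 2 ^ t * 2 powi g" "Emin \<le> g" "g \<le> Emax"
    using floats_cases [OF fl_in] by metis
  show ?thesis
  proof (cases "h \<le> g")
    case True
    thus ?thesis using g on_grid_finer by blast
  next
    case False
    hence "fl r = r" using fl_exact_if_finer [OF assms g(2,3)] assms by auto
    thus ?thesis using assms by simp
  qed
qed

section \<open>Exactly representable sums, differences and rounding errors\<close>

text \<open>The finer of the two exponents serves for \<open>r\<close>: both \<open>a\<close> and
  \<open>b\<close> lie on its grid, and the one represented at that exponent bounds the significand.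
  Which of them it is depends on the case, hence both bounds.\<close>

lemma floats_if_le_both:
  assumes "a \<in> D" "b \<in> D" "\<bar>r\<bar> \<le> \<bar>a\<bar>" "\<bar>r\<bar> \<le> \<bar>b\<bar>"
    and grid: "\<And>h. Emin \<le> h \<Longrightarrow> h \<le> Emax \<Longrightarrow> on_grid h a \<Longrightarrow> on_grid h b \<Longrightarrow> on_grid h r"
  shows "r \<in> D"
proof -
  obtain h where h: "on_grid h a" "\<bar>a\<bar> < 2 ^ t * 2 powi h" "Emin \<le> h" "h \<le> Emax"
    using floats_cases [OF assms(1)] by metis
  obtain g where g: "on_grid g b" "\<bar>b\<bar> < 2 ^ t * 2 powi g" "Emin \<le> g" "g \<le> Emax"
    using floats_cases [OF assms(2)] by metis
  show ?thesis
  proof (cases "h \<le> g")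
    case True
    hence "on_grid h r" using grid h g on_grid_finer by blast
    thus ?thesis using h assms(3) floatsI by fastforce
  next
    case False
    hence "on_grid g r" using grid [OF g(3,4) on_grid_finer [OF h(1)] g(1)] by simp
    thus ?thesis using g assms(4) floatsI by fastforce
  qed
qed

text \<open>Each summand is a candidate for the rounded sum and misses the exact sum by the other
  summand.\<close>

lemma abs_error_le:
  assumes "a \<in> D" "b \<in> D"
  shows "\<bar>fl (a + b) - (a + b)\<bar> \<le> \<bar>a\<bar>" "\<bar>fl (a + b) - (a + b)\<bar> \<le> \<bar>b\<bar>"
  using fl_nearest [of a "a + b"] fl_nearest [of b "a + b"] assms by auto

text \<open>Rounding keeps the sum on any admissible grid shared by the summands, so the error lies
  there too and is no larger than either of them.\<close>

lemma error_in_floats: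
  assumes "a \<in> D" "b \<in> D"
  shows "fl (a + b) - (a + b) \<in> D"
  using assms by (rule floats_if_le_both) (auto intro: abs_error_le assms on_grid_diff on_grid_add on_grid_fl)

lemma sum_in_floats_if_le:
  assumes "a \<in> D" "b \<in> D" "\<bar>a + b\<bar> \<le> \<bar>a\<bar>" "\<bar>a + b\<bar> \<le> \<bar>b\<bar>"
  shows "a + b \<in> D"
  using assms by (rule floats_if_le_both) (auto intro: on_grid_add)

text \<open>In this range the points of grid \<open>h + 1\<close> no larger than \<open>r\<close>
  are floats, and one of them is at most one step of grid \<open>h\<close> away.\<close>

lemma abs_error_le_grid:
  assumes "on_grid h r" "\<bar>r\<bar> < 2 * (2 ^ t * 2 powi h)" "Emin \<le> h" "h < Emax"
  shows "\<bar>fl r - r\<bar> \<le> 2 powi h"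
proof -
  obtain k :: int where k: "r = of_int k * 2 powi h"
    using assms by (auto simp: on_grid_def)
  have pw: "(2::real) powi (h + 1) = 2 * 2 powi h"
    by (simp add: power_int_add)
  \<comment> \<open>\<open>2 * j\<close> is \<open>k\<close> rounded towards zero to an even number, so its size stays admissible.\<close>
  define j where "j = (if k \<ge> 0 then k div 2 else - ((- k) div 2))"
  have j: "\<bar>2 * j - k\<bar> \<le> 1" "2 * \<bar>j\<bar> \<le> \<bar>k\<bar>" unfolding j_def by (auto split: if_splits)
  define a where "a = real_of_int j * 2 powi (h + 1)"
  have "\<bar>real_of_int (2 * j)\<bar> \<le> \<bar>real_of_int k\<bar>" using j(2) by linarith
  hence "\<bar>real_of_int (2 * j) * 2 powi h\<bar> \<le> \<bar>real_of_int k * 2 powi h\<bar>"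
    unfolding abs_mult [of _ "2 powi h"] by (rule mult_right_mono) simp
  moreover have "real_of_int (2 * j) * 2 powi h = a" by (simp add: a_def pw)
  ultimately have "\<bar>a\<bar> \<le> \<bar>r\<bar>" by (simp only: k)
  hence "a \<in> D"
    using assms by (intro floatsI [of "h + 1"]) (auto simp: on_grid_def a_def pw)
  hence "\<bar>fl r - r\<bar> \<le> \<bar>a - r\<bar>" by (rule fl_nearest)
  also have "a - r = real_of_int (2 * j - k) * 2 powi h"
    unfolding a_def k pw by (simp add: algebra_simps)
  also have "\<bar>\<dots>\<bar> = \<bar>real_of_int (2 * j - k)\<bar> * 2 powi h" by (simp add: abs_mult)
  also have "\<dots> \<le> 1 * 2 powi h"
    using j(1) by (intro mult_right_mono) (linarith, simp)
  finally show ?thesis by simp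
qed

text \<open>The exponents \<open>h\<close> of \<open>a\<close>, \<open>f\<close> of \<open>b\<close>
  and \<open>g\<close> of the rounded sum are compared. Either the sum is exact, or the difference,
  of size at most twice that of \<open>b\<close>, fits at an exponent above \<open>f\<close>, or
  \<open>f = h\<close> and a sharper error bound is needed.\<close>

lemma fl_sum_minus_larger_in_floats:
  assumes ab: "a \<in> D" "b \<in> D" "\<bar>b\<bar> \<le> \<bar>a\<bar>"
    and ovf: "no_overflow t Emax (a + b)"
  shows "fl (a + b) - a \<in> D"
proof -
  obtain h where h: "on_grid h a" "\<bar>a\<bar> < 2 ^ t * 2 powi h" "Emin \<le> h" "h \<le> Emax"
    using floats_cases [OF ab(1)] by metis
  obtain f' where f': "on_grid f' b" "\<bar>b\<bar> < 2 ^ t * 2 powi f'" "Emin \<le> f'" "f' \<le> Emax"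
    using floats_cases [OF ab(2)] by metis
  \<comment> \<open>If the given exponent of \<open>b\<close> exceeds \<open>h\<close>, then
    \<open>h\<close> itself serves for \<open>b\<close>, since \<open>b\<close> is no larger than
    \<open>a\<close>.\<close>
  obtain f where f: "on_grid f b" "\<bar>b\<bar> < 2 ^ t * 2 powi f" "Emin \<le> f" "f \<le> h"
  proof (cases "f' \<le> h")
    case False
    hence "on_grid h b" using f' on_grid_finer by auto
    thus ?thesis using that h ab(3) by force
  qed (use f' that in auto)
  have sum: "on_grid f (a + b)" using f h on_grid_finer on_grid_add by blast
  obtain g where g: "on_grid g (fl (a + b))" "\<bar>fl (a + b)\<bar> < 2 ^ t * 2 powi g"
      "Emin \<le> g" "g \<le> Emax"
    using floats_cases [OF fl_in] by metis
  have err: "\<bar>fl (a + b) - (a + b)\<bar> \<le> \<bar>b\<bar>" by (rule abs_error_le [OF ab(1,2)])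
  consider "g \<le> f" | "f < g" "f < h" | "f < g" "f = h" using f(4) by linarith
  thus ?thesis
  proof cases
    case 1
    have "fl (a + b) = a + b"
      by (rule fl_exact_if_finer [OF sum _ _ g(2,3)]) (use 1 f h ovf in auto)
    thus ?thesis using ab by simp
  next
    case 2
    \<comment> \<open>The difference is at most \<open>b\<close> plus the error in size, hence below
      \<open>2 ^ t * 2 powi (f + 1)\<close>, and \<open>f + 1\<close> does not exceed
      \<open>?m\<close>.\<close>
    let ?m = "min g h"
    have "(2::real) powi (f + 1) \<le> 2 powi ?m" using 2 by (intro power_int_increasing) auto
    hence "2 * 2 powi f \<le> (2::real) powi ?m" by (simp add: power_int_add)
    hence "2 ^ t * (2 * 2 powi f) \<le> 2 ^ t * (2::real) powi ?m" by (intro mult_left_mono) auto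
    hence "\<bar>fl (a + b) - a\<bar> < 2 ^ t * 2 powi ?m" using err f(2) by linarith
    moreover have "on_grid ?m (fl (a + b) - a)"
      using g(1) h(1) by (intro on_grid_diff) (auto elim: on_grid_finer)
    ultimately show ?thesis using g h by (intro floatsI [of ?m]) auto
  next
    case 3
    \<comment> \<open>Bounding the error by \<open>b\<close> would lose a factor of 2. An error of
      one grid step on top of a significand of at most \<open>2 ^ t - 1\<close> gives at most
      \<open>2 ^ t\<close>, which is admissible because \<open>h < g \<le> Emax\<close>.\<close>
    have "\<bar>fl (a + b) - (a + b)\<bar> \<le> 2 powi h"
      using sum 3 f h g by (intro abs_error_le_grid) auto
    moreover have "\<bar>b\<bar> \<le> (2 ^ t - 1) * 2 powi h"
    proof -
      obtain k :: int where k: "b = of_int k * 2 powi h" using f(1) 3 by (auto simp: on_grid_def)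
      have "\<bar>real_of_int k\<bar> < 2 ^ t" using f(2) 3 by (simp add: k abs_mult)
      hence "\<bar>k\<bar> < 2 ^ t" by (metis of_int_abs of_int_less_iff of_int_numeral of_int_power)
      hence "\<bar>k\<bar> \<le> 2 ^ t - 1" by simp
      hence "real_of_int \<bar>k\<bar> \<le> real_of_int (2 ^ t - 1)" by (simp only: of_int_le_iff)
      thus ?thesis by (simp add: k abs_mult)
    qed
    ultimately have "\<bar>fl (a + b) - a\<bar> \<le> 2 ^ t * 2 powi h" by (simp add: algebra_simps)
    moreover have "on_grid h (fl (a + b) - a)"
      using g(1) h(1) 3 by (intro on_grid_diff) (auto elim: on_grid_finer)
    ultimately show ?thesis using 3 h g by (intro floatsI_le) auto
  qed
qed

section \<open>Relative rounding errors\<close>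

text \<open>Small values on the finest grid are floats, so underflow costs nothing. Otherwise
  \<open>h\<close> is chosen so that \<open>r\<close> has exactly \<open>t\<close> digits before the
  binary point in units of \<open>2 powi h\<close>; the nearest multiple of that unit is a float at
  most half a unit away.\<close>

lemma relative_error:
  assumes r: "on_grid Emin r" "no_overflow t Emax r" and E: "Emin \<le> Emax"
  shows "\<bar>fl r - r\<bar> \<le> unit_roundoff t * \<bar>r\<bar>"
proof (cases "\<bar>r\<bar> < 2 ^ t * 2 powi Emin")
  case True
  hence "fl r = r" using floatsI [OF r(1)] E fl_eq by auto
  thus ?thesis by (simp add: unit_roundoff_def)
next
  case False
  define l where "l = \<lfloor>log 2 \<bar>r\<bar>\<rfloor>"
  define h where "h = l + 1 - int t"
  have "0 < (2::real) ^ t * 2 powi Emin" by simp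
  hence r0: "\<bar>r\<bar> > 0" using False by linarith
  have "2 powr l \<le> \<bar>r\<bar> \<and> \<bar>r\<bar> < 2 powr (l + 1)"
    using floor_log_eq_powr_iff [of "\<bar>r\<bar>" 2 l] r0 l_def by simp
  hence l: "2 powi l \<le> \<bar>r\<bar>" "\<bar>r\<bar> < 2 powi (l + 1)"
    using powr_real_of_int' [of 2 "l + 1"] by (auto simp: powr_real_of_int')
  have th: "(2::real) ^ t * 2 powi h = 2 powi (l + 1)"
    by (simp add: h_def power_int_diff)
  have pos: "(0::real) < 2 powi h" by simp
  have "(2::real) powi (int t + Emin) < 2 powi (l + 1)"
    using False l(2) by (simp add: power_int_add)
  hence hE: "Emin \<le> h" unfolding h_def
    using power_int_increasing [of "l + 1" "int t + Emin" "2::real"] by force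
  have rle: "\<bar>r\<bar> \<le> (2 ^ t - 1) * 2 powi Emax" using r(2) by (simp add: no_overflow_def)
  also have "\<dots> < 2 powi (int t + Emax)" by (simp add: power_int_add)
  finally have "(2::real) powi l < 2 powi (int t + Emax)" using l(1) by linarith
  hence hM: "h \<le> Emax" unfolding h_def
    using power_int_increasing [of "int t + Emax" l "2::real"] by force
  define a where "a = real_of_int (round (r / 2 powi h)) * 2 powi h"
  have ag: "on_grid h a" by (auto simp: on_grid_def a_def)
  have rb: "\<bar>round q\<bar> \<le> c" if "\<bar>q\<bar> \<le> real_of_int c" for q :: real and c
    using that round_mono [of q "of_int c"] round_mono [of "- of_int c" q]
    by (metis abs_le_iff minus_le_iff of_int_minus round_of_int)
  have bnd: "\<bar>a\<bar> \<le> real_of_int c * 2 powi h" if "\<bar>r\<bar> \<le> real_of_int c * 2 powi h" for c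
  proof -
    have "\<bar>r / 2 powi h\<bar> \<le> real_of_int c" using that by (simp add: field_simps)
    from rb [OF this] have "\<bar>real_of_int (round (r / 2 powi h))\<bar> \<le> real_of_int c" by linarith
    thus ?thesis by (simp add: a_def abs_mult)
  qed
  have "a \<in> D"
  \<comment> \<open>Rounding the significand may produce \<open>2 ^ t\<close>, admissible only below
    \<open>Emax\<close>; at \<open>Emax\<close> absence of overflow keeps it at most
    \<open>2 ^ t - 1\<close>.\<close>
  proof (cases "h < Emax")
    case True
    thus ?thesis using bnd [of "2 ^ t"] l(2) th ag hE by (intro floatsI_le [of h]) auto
  next
    case False
    hence "h = Emax" using hM by simp
    with bnd [of "2 ^ t - 1"] rle have "\<bar>a\<bar> \<le> (2 ^ t - 1) * 2 powi h" by simp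
    also have "\<dots> < 2 ^ t * 2 powi h" by simp
    finally show ?thesis using ag hE hM by (intro floatsI)
  qed
  hence "\<bar>fl r - r\<bar> \<le> \<bar>a - r\<bar>" by (rule fl_nearest)
  also have "a - r = (real_of_int (round (r / 2 powi h)) - r / 2 powi h) * 2 powi h"
    by (simp add: a_def field_simps)
  also have "\<bar>\<dots>\<bar> \<le> 1 / 2 * 2 powi h"
    unfolding abs_mult using of_int_round_abs_le [of "r / 2 powi h"] by (intro mult_mono) auto
  also have "\<dots> = unit_roundoff t * 2 powi l"
    by (simp add: unit_roundoff_def h_def power_int_diff power_int_add)
  also have "\<dots> \<le> unit_roundoff t * \<bar>r\<bar>"
    using l(1) by (intro mult_left_mono) (auto simp: unit_roundoff_def)
  finally show ?thesis .
qed

lemma relative_error_sum: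
  assumes "a \<in> D" "b \<in> D" "no_overflow t Emax (a + b)"
  shows "\<exists>\<delta>. \<bar>\<delta>\<bar> \<le> unit_roundoff t \<and> fl (a + b) = (1 + \<delta>) * (a + b)"
proof -
  have "on_grid Emin c" "Emin \<le> Emax" if "c \<in> D" for c
    using floats_cases [OF that] on_grid_finer by (metis, force)
  hence le: "\<bar>fl (a + b) - (a + b)\<bar> \<le> unit_roundoff t * \<bar>a + b\<bar>"
    using assms by (intro relative_error on_grid_add) auto
  \<comment> \<open>For a zero sum the value 0 is right, because \<open>le\<close> then forces the
    rounded sum to vanish.\<close>
  define \<delta> where "\<delta> = (if a + b = 0 then 0 else (fl (a + b) - (a + b)) / (a + b))"
  have "\<bar>\<delta>\<bar> \<le> unit_roundoff t"
    using le by (auto simp: \<delta>_def unit_roundoff_def field_simps)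
  moreover have "\<delta> * (a + b) = fl (a + b) - (a + b)"
    using le by (auto simp: \<delta>_def)
  hence "fl (a + b) = (1 + \<delta>) * (a + b)"
    by (simp add: algebra_simps)
  ultimately show ?thesis by blast
qed

section \<open>Exactness of the compensated addition\<close>

lemma add6_exact:
  assumes xy: "x \<in> D" "y \<in> D"
    and ovf: "\<forall>r\<in>add6_exact_results fl x y. no_overflow t Emax r"
    and add6: "(z, zz) = add6 fl x y"
  shows "z + zz = x + y"
proof -
  define w where "w = fl (z - x)"
  define z1 where "z1 = fl (y - w)"
  define v where "v = fl (w - z)"
  define z2 where "z2 = fl (x + v)"
  have z: "z = fl (x + y)" and zz: "zz = fl (z1 + z2)"
    using add6 by (auto simp: add6_def Let_def w_def z1_def v_def z2_def)
  have ovf: "no_overflow t Emax (x + y)" "no_overflow t Emax (z - x)"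
    using ovf by (auto simp: add6_exact_results_def Let_def z)
  have D: "z \<in> D" "w \<in> D" by (auto simp: z w_def)
  have err: "z - (x + y) \<in> D" "\<bar>z - (x + y)\<bar> \<le> \<bar>x\<bar>" "\<bar>z - (x + y)\<bar> \<le> \<bar>y\<bar>"
    using error_in_floats abs_error_le xy by (auto simp: z)
  have err': "x + y - z \<in> D" using err(1) floats_minus_commute by blast
  have "z1 + z2 = x + y - z"
  proof (cases "z - x \<in> D")
    case True
    hence "w = z - x" by (simp add: w_def fl_eq)
    moreover have "z1 = x + y - z"
      using fl_eq [OF err'] by (simp add: z1_def calculation algebra_simps)
    moreover have "fl 0 = 0"
      using fl_eq [OF zero_in_floats [OF xy(1)]] .
    ultimately show ?thesis using xy by (simp add: v_def z2_def fl_eq)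
  next
    case False
    hence xly: "\<bar>x\<bar> < \<bar>y\<bar>"
      using fl_sum_minus_larger_in_floats [OF xy _ ovf(1)] unfolding z by force
    have xz: "\<bar>x\<bar> \<le> \<bar>z\<bar>"
    proof (rule ccontr)
      assume "\<not> ?thesis"
      hence "\<bar>x + y\<bar> \<le> \<bar>x\<bar>" using abs_le_abs_fl [OF xy(1), of "x + y"] unfolding z by linarith
      hence "x + y \<in> D" using xy xly by (intro sum_in_floats_if_le) auto
      hence "z - x = y" by (simp add: z fl_eq)
      thus False using False xy by simp
    qed
    have "fl (z + (- x)) - z \<in> D"
      by (rule fl_sum_minus_larger_in_floats) (use xz xy D ovf in auto)
    hence v: "v = w - z" by (simp add: v_def w_def fl_eq)
    have "fl (z + (- x)) - (z + (- x)) \<in> D"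
      by (rule error_in_floats) (use xy D in auto)
    hence z2: "z2 = x + w - z" by (simp add: z2_def v w_def fl_eq algebra_simps)
    \<comment> \<open>The argument of \<open>fl\<close> equals \<open>z - x\<close>, so its rounding
      is \<open>w\<close>; writing it as \<open>y\<close> plus an error makes \<open>y\<close> the
      larger summand.\<close>
    have "fl (y + (z - (x + y))) - y \<in> D"
      by (rule fl_sum_minus_larger_in_floats) (use xy err ovf in auto)
    hence "w - y \<in> D" by (simp add: w_def)
    hence "z1 = y - w" using floats_minus_commute fl_eq by (simp add: z1_def)
    thus ?thesis using z2 by simp
  qed
  thus ?thesis using fl_eq [OF err'] by (simp add: zz)
qed

end

section \<open>Real products and linear recurrences\<close>

text \<open>Induction: the bound for \<open>m\<close> factors gives a product of size at most
  \<open>1 / (1 - m * u)\<close>, so one more factor adds at most \<open>u / (1 - m * u)\<close>.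
  The numerators add up to \<open>(m + 1) * u\<close>, and shrinking the denominator only enlarges
  the bound.\<close>

lemma abs_prod_diff_1_le:
  fixes f :: "nat \<Rightarrow> real"
  assumes "finite A" "\<And>i. i \<in> A \<Longrightarrow> \<bar>f i\<bar> \<le> u" "real (card A) * u < 1" "u \<ge> 0"
  shows "\<bar>(\<Prod>i\<in>A. 1 - f i) - 1\<bar> \<le> real (card A) * u / (1 - real (card A) * u)"
  using assms
proof (induction A rule: finite_induct)
  case (insert a A)
  define m where "m = real (card A)"
  define P where "P = (\<Prod>i\<in>A. 1 - f i)"
  have lt: "(m + 1) * u < 1" using insert by (simp add: m_def add_ac)
  hence lt': "m * u < 1" using insert.prems by (simp add: algebra_simps)
  have IH: "\<bar>P - 1\<bar> \<le> m * u / (1 - m * u)"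
    unfolding P_def m_def by (rule insert.IH) (use insert.prems lt' in \<open>auto simp: m_def\<close>)
  have "\<bar>P\<bar> \<le> 1 + m * u / (1 - m * u)" using IH by linarith
  also have "\<dots> = 1 / (1 - m * u)" using lt' by (simp add: field_simps)
  finally have P: "\<bar>P\<bar> \<le> 1 / (1 - m * u)" .
  have "(1 - f a) * P - 1 = (P - 1) - f a * P" by (simp add: algebra_simps)
  also have "\<bar>\<dots>\<bar> \<le> \<bar>P - 1\<bar> + \<bar>f a\<bar> * \<bar>P\<bar>"
    using abs_triangle_ineq4 [of "P - 1" "f a * P"] by (simp add: abs_mult)
  also have "\<dots> \<le> m * u / (1 - m * u) + u * (1 / (1 - m * u))"
    using insert.prems by (intro add_mono mult_mono IH P) auto
  also have "\<dots> = (m + 1) * u / (1 - m * u)" by (simp add: add_divide_distrib algebra_simps)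
  also have "\<dots> \<le> (m + 1) * u / (1 - (m + 1) * u)"
    using lt lt' insert.prems by (intro frac_le) (auto simp: m_def algebra_simps)
  finally show ?case using insert by (simp add: P_def m_def add_ac)
qed auto

lemma linear_recurrence_solution:
  fixes S a b :: "nat \<Rightarrow> real"
  assumes "S 0 = 0" "\<And>i. i \<in> {1..n} \<Longrightarrow> S i = a i * S (i - 1) + b i"
  shows "S n = (\<Sum>k=1..n. (\<Prod>i=k+1..n. a i) * b k)"
  using assms(2)
proof (induction n)
  case (Suc n)
  have "S (Suc n) = a (Suc n) * S n + b (Suc n)" using Suc.prems [of "Suc n"] by simp
  also have "S n = (\<Sum>k=1..n. (\<Prod>i=k+1..n. a i) * b k)" using Suc by simp
  \<comment> \<open>Every product gains its top factor; the remaining \<open>b (Suc n)\<close> is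
    the summand with the empty product.\<close>
  also have "a (Suc n) * \<dots> = (\<Sum>k=1..n. (\<Prod>i=k+1..Suc n. a i) * b k)"
    unfolding sum_distrib_left by (intro sum.cong) (auto simp: prod.nat_ivl_Suc' mult_ac)
  finally show ?case by simp
qed (simp add: assms(1))

lemma div_1_minus_mono:
  fixes c d u w :: real
  assumes "0 \<le> c" "c \<le> d" "0 \<le> u" "d * u < 1" "0 \<le> w"
  shows "c * w / (1 - c * u) \<le> d * w / (1 - d * u)"
  using assms mult_right_mono [of c d u] by (intro frac_le mult_right_mono mult_nonneg_nonneg) auto

section \<open>Error analysis of the compensated summation\<close>

theorem mainTheorem3:
  fixes t n :: nat and Emin Emax :: int
    and fl :: "real \<Rightarrow> real"
    and x y s e :: "nat \<Rightarrow> real"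
    and \<epsilon> stilde :: real
  assumes "t \<ge> 1" and "Emin \<le> Emax"
    and "nearest_rounding (dekker_floats t Emin Emax) fl"
    and "\<epsilon> = unit_roundoff t"
    and "n \<ge> 1"
    and "\<forall>i\<in>{1..n}. x i \<in> dekker_floats t Emin Emax"
    and "stilde = (\<Sum>k=1..n. x k)"
    and "s 0 = 0" and "e 0 = 0"
    and "\<forall>i\<in>{1..n}. y i = fl (e (i - 1) + x i)"
    and "\<forall>i\<in>{1..n}. (s i, e i) = add6 fl (s (i - 1)) (y i)"
    and "\<forall>i\<in>{1..n}. no_overflow t Emax (e (i - 1) + x i)"
    and "\<forall>i\<in>{1..n}. \<forall>r\<in>add6_exact_results fl (s (i - 1)) (y i). no_overflow t Emax r"
  shows "(\<exists>\<alpha> \<beta> :: nat \<Rightarrow> real.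
            \<beta> 0 = 0 \<and>
            (\<forall>i\<in>{1..n}. \<bar>\<alpha> i\<bar> \<le> \<epsilon> \<and> \<bar>\<beta> i\<bar> \<le> \<epsilon>) \<and>
            (\<forall>i\<in>{1..n}.
               y i = (1 + \<alpha> i) * (e (i - 1) + x i) \<and>
               s i = (1 + \<beta> i) * (s (i - 1) + y i) \<and>
               e i = - \<beta> i * (s (i - 1) + y i) \<and>
               s i + e i = (1 - \<alpha> i * \<beta> (i - 1)) * (s (i - 1) + e (i - 1)) + (1 + \<alpha> i) * x i) \<and>
            s n + e n = (\<Sum>k=1..n. (\<Prod>i=k+1..n. 1 - \<alpha> i * \<beta> (i - 1)) * (1 + \<alpha> k) * x k))
       \<and> (real n * \<epsilon>\<^sup>2 < 1 \<longrightarrow>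
            \<bar>s n + e n - stilde\<bar>
              \<le> \<epsilon> * (\<Sum>k=1..n. \<bar>x k\<bar>)
                + (\<Sum>k=1..n. real (n - k) * \<epsilon>\<^sup>2 / (1 - real (n - k) * \<epsilon>\<^sup>2) * \<bar>x k\<bar>)
                + (\<Sum>k=1..n. real (n - k) * \<epsilon> ^ 3 / (1 - real (n - k) * \<epsilon>\<^sup>2) * \<bar>x k\<bar>)
          \<and> \<epsilon> * (\<Sum>k=1..n. \<bar>x k\<bar>)
                + (\<Sum>k=1..n. real (n - k) * \<epsilon>\<^sup>2 / (1 - real (n - k) * \<epsilon>\<^sup>2) * \<bar>x k\<bar>)
                + (\<Sum>k=1..n. real (n - k) * \<epsilon> ^ 3 / (1 - real (n - k) * \<epsilon>\<^sup>2) * \<bar>x k\<bar>)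
              \<le> \<epsilon> * (\<Sum>k=1..n. \<bar>x k\<bar>)
                + real (n - 1) * \<epsilon>\<^sup>2 / (1 - real (n - 1) * \<epsilon>\<^sup>2) * (\<Sum>k=1..n. \<bar>x k\<bar>)
                + real (n - 1) * \<epsilon> ^ 3 / (1 - real (n - 1) * \<epsilon>\<^sup>2) * (\<Sum>k=1..n. \<bar>x k\<bar>)
          \<and> \<bar>s n - stilde\<bar>
              \<le> (1 + \<epsilon>) *
                  (\<epsilon> * (\<Sum>k=1..n. \<bar>x k\<bar>)
                   + real (n - 1) * \<epsilon>\<^sup>2 / (1 - real (n - 1) * \<epsilon>\<^sup>2) * (\<Sum>k=1..n. \<bar>x k\<bar>)
                   + real (n - 1) * \<epsilon> ^ 3 / (1 - real (n - 1) * \<epsilon>\<^sup>2) * (\<Sum>k=1..n. \<bar>x k\<bar>))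
                + \<epsilon> * \<bar>\<Sum>k=1..n. x k\<bar>)"
proof -
  interpret dekker_rounding t Emin Emax fl
    using assms(1,3) by unfold_locales
  have \<epsilon>0: "\<epsilon> \<ge> 0" by (simp add: assms(4) unit_roundoff_def)
  have s: "s i = fl (s (i - 1) + y i)" and D1: "s i \<in> D" "e i \<in> D" "y i \<in> D" if "i \<in> {1..n}" for i
    using bspec [OF assms(11) that] bspec [OF assms(10) that] by (auto simp: add6_def Let_def)
  have "0 \<in> D"
    using zero_in_floats [OF fl_in] .
  hence D: "s i \<in> D" "e i \<in> D" if "i \<le> n" for i
    using D1 [of i] that assms(8,9) by (cases "i = 0"; simp)+
  have exact: "s i + e i = s (i - 1) + y i" if "i \<in> {1..n}" for i
    by (rule add6_exact) (use that D D1 assms(11,13) in auto)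
  have "\<exists>a. \<bar>a\<bar> \<le> \<epsilon> \<and> y i = (1 + a) * (e (i - 1) + x i)" if "i \<in> {1..n}" for i
    using relative_error_sum [of "e (i - 1)" "x i"] that D assms by auto
  then obtain \<alpha> where \<alpha>: "\<And>i. i \<in> {1..n} \<Longrightarrow> \<bar>\<alpha> i\<bar> \<le> \<epsilon>"
      "\<And>i. i \<in> {1..n} \<Longrightarrow> y i = (1 + \<alpha> i) * (e (i - 1) + x i)" by metis
  have "\<exists>b. \<bar>b\<bar> \<le> \<epsilon> \<and> s i = (1 + b) * (s (i - 1) + y i)" if i: "i \<in> {1..n}" for i
  proof -
    have "no_overflow t Emax (s (i - 1) + y i)"
      using bspec [OF assms(13) i] by (auto simp: add6_exact_results_def Let_def)
    thus ?thesis using relative_error_sum [of "s (i - 1)" "y i"] i D D1 s [OF i] assms(4) by auto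
  qed
  then obtain \<beta>' where \<beta>': "\<And>i. i \<in> {1..n} \<Longrightarrow> \<bar>\<beta>' i\<bar> \<le> \<epsilon>"
      "\<And>i. i \<in> {1..n} \<Longrightarrow> s i = (1 + \<beta>' i) * (s (i - 1) + y i)" by metis
  \<comment> \<open>The choice above fixes values only on \<open>{1..n}\<close>; index 0 is set
    separately because the recurrence at \<open>i = 1\<close> refers to it.\<close>
  define \<beta> where "\<beta> = \<beta>'(0 := 0)"
  have \<beta>0: "\<beta> 0 = 0"
    and \<beta>: "\<And>i. i \<in> {1..n} \<Longrightarrow> \<bar>\<beta> i\<bar> \<le> \<epsilon>"
      "\<And>i. i \<in> {1..n} \<Longrightarrow> s i = (1 + \<beta> i) * (s (i - 1) + y i)"
    using \<beta>' by (auto simp: \<beta>_def)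
  have e: "e i = - \<beta> i * (s (i - 1) + y i)" if "i \<in> {1..n}" for i
    using exact [OF that] \<beta>(2) [OF that] by (simp add: algebra_simps)
  \<comment> \<open>Expressed through \<open>s i + e i\<close> and including \<open>i = 0\<close>,
    the relation can be used at \<open>i - 1\<close> to eliminate \<open>e (i - 1)\<close> from the
    recurrence.\<close>
  have e': "e i = - \<beta> i * (s i + e i)" if "i \<le> n" for i
    using e [of i] exact [of i] that assms(9) \<beta>0 by (cases "i = 0") auto
  have rec: "s i + e i = (1 - \<alpha> i * \<beta> (i - 1)) * (s (i - 1) + e (i - 1)) + (1 + \<alpha> i) * x i"
    if i: "i \<in> {1..n}" for i
  proof -
    have "s i + e i = s (i - 1) + e (i - 1) + \<alpha> i * e (i - 1) + (1 + \<alpha> i) * x i"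
      using exact [OF i] \<alpha>(2) [OF i] by (simp add: algebra_simps)
    also have "\<alpha> i * e (i - 1) = \<alpha> i * (- \<beta> (i - 1) * (s (i - 1) + e (i - 1)))"
      using e' [of "i - 1"] i by (intro arg_cong [of _ _ "(*) (\<alpha> i)"]) auto
    finally show ?thesis by (simp add: algebra_simps)
  qed
  define P where "P k = (\<Prod>i=k+1..n. 1 - \<alpha> i * \<beta> (i - 1))" for k
  have sol: "s n + e n = (\<Sum>k=1..n. P k * (1 + \<alpha> k) * x k)"
    using linear_recurrence_solution [of "\<lambda>i. s i + e i" n "\<lambda>i. 1 - \<alpha> i * \<beta> (i - 1)"
        "\<lambda>i. (1 + \<alpha> i) * x i"] assms(8,9) rec by (simp add: P_def mult.assoc)
  show ?thesis
  proof (intro conjI impI)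
    show "\<exists>\<alpha> \<beta> :: nat \<Rightarrow> real.
            \<beta> 0 = 0 \<and>
            (\<forall>i\<in>{1..n}. \<bar>\<alpha> i\<bar> \<le> \<epsilon> \<and> \<bar>\<beta> i\<bar> \<le> \<epsilon>) \<and>
            (\<forall>i\<in>{1..n}.
               y i = (1 + \<alpha> i) * (e (i - 1) + x i) \<and>
               s i = (1 + \<beta> i) * (s (i - 1) + y i) \<and>
               e i = - \<beta> i * (s (i - 1) + y i) \<and>
               s i + e i = (1 - \<alpha> i * \<beta> (i - 1)) * (s (i - 1) + e (i - 1)) + (1 + \<alpha> i) * x i) \<and>
            s n + e n = (\<Sum>k=1..n. (\<Prod>i=k+1..n. 1 - \<alpha> i * \<beta> (i - 1)) * (1 + \<alpha> k) * x k)"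
      by (rule exI [of _ \<alpha>], rule exI [of _ \<beta>])
        (use \<beta>0 \<alpha> \<beta> e rec sol in \<open>simp add: P_def\<close>)
  next
    assume n\<epsilon>: "real n * \<epsilon>\<^sup>2 < 1"
    have small: "real m * \<epsilon>\<^sup>2 < 1" if "m \<le> n" for m
      using mult_right_mono [of "real m" "real n" "\<epsilon>\<^sup>2"] that n\<epsilon> by simp
    define \<gamma> where "\<gamma> m = real m * \<epsilon>\<^sup>2 / (1 - real m * \<epsilon>\<^sup>2)" for m
    have \<gamma>\<epsilon>: "real m * \<epsilon> ^ 3 / (1 - real m * \<epsilon>\<^sup>2) = \<gamma> m * \<epsilon>" for m
      by (simp add: \<gamma>_def power3_eq_cube power2_eq_square)
    have \<gamma>0: "\<gamma> m \<ge> 0" if "m \<le> n" for m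
      using small [OF that] by (simp add: \<gamma>_def)
    let ?A = "\<Sum>k=1..n. \<bar>x k\<bar>"
    let ?B = "\<epsilon> * ?A + (\<Sum>k=1..n. \<gamma> (n - k) * \<bar>x k\<bar>) + (\<Sum>k=1..n. \<gamma> (n - k) * \<epsilon> * \<bar>x k\<bar>)"
    let ?C = "\<epsilon> * ?A + \<gamma> (n - 1) * ?A + \<gamma> (n - 1) * \<epsilon> * ?A"
    have coeff: "\<bar>P k * (1 + \<alpha> k) - 1\<bar> \<le> \<epsilon> + \<gamma> (n - k) + \<gamma> (n - k) * \<epsilon>" if k: "k \<in> {1..n}" for k
    proof -
      \<comment> \<open>Since \<open>i > k \<ge> 1\<close>, the index \<open>i - 1\<close> is still
        in \<open>{1..n}\<close>.\<close>
      have "\<bar>\<alpha> i * \<beta> (i - 1)\<bar> \<le> \<epsilon>\<^sup>2" if "i \<in> {k+1..n}" for i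
        unfolding abs_mult power2_eq_square using that k \<alpha>(1) [of i] \<beta>(1) [of "i - 1"] \<epsilon>0
        by (intro mult_mono) force+
      hence P: "\<bar>P k - 1\<bar> \<le> \<gamma> (n - k)"
        using abs_prod_diff_1_le [of "{k+1..n}" "\<lambda>i. \<alpha> i * \<beta> (i - 1)" "\<epsilon>\<^sup>2"] small [of "n - k"]
        by (simp add: P_def \<gamma>_def)
      \<comment> \<open>The three terms yield the three sums of the bound, of orders 1, 2 and 3 in
        \<epsilon>.\<close>
      have "P k * (1 + \<alpha> k) - 1 = \<alpha> k + (P k - 1) + (P k - 1) * \<alpha> k" by (simp add: algebra_simps)
      also have "\<bar>\<dots>\<bar> \<le> \<bar>\<alpha> k\<bar> + \<bar>P k - 1\<bar> + \<bar>P k - 1\<bar> * \<bar>\<alpha> k\<bar>"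
        unfolding abs_mult [symmetric] by linarith
      also have "\<dots> \<le> \<epsilon> + \<gamma> (n - k) + \<gamma> (n - k) * \<epsilon>"
        using P \<alpha>(1) [OF k] \<gamma>0 [of "n - k"] by (intro add_mono mult_mono) auto
      finally show ?thesis .
    qed
    have "s n + e n - stilde = (\<Sum>k=1..n. (P k * (1 + \<alpha> k) - 1) * x k)"
      by (simp add: sol assms(7) sum_subtractf left_diff_distrib)
    also have "\<bar>\<dots>\<bar> \<le> (\<Sum>k=1..n. (\<epsilon> + \<gamma> (n - k) + \<gamma> (n - k) * \<epsilon>) * \<bar>x k\<bar>)"
      by (rule order_trans [OF sum_abs sum_mono])
        (use coeff in \<open>simp add: abs_mult mult_right_mono\<close>)
    also have "\<dots> = ?B"
      by (simp add: distrib_right sum.distrib sum_distrib_left)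
    finally have B: "\<bar>s n + e n - stilde\<bar> \<le> ?B" .
    thus "\<bar>s n + e n - stilde\<bar>
              \<le> \<epsilon> * (\<Sum>k=1..n. \<bar>x k\<bar>)
                + (\<Sum>k=1..n. real (n - k) * \<epsilon>\<^sup>2 / (1 - real (n - k) * \<epsilon>\<^sup>2) * \<bar>x k\<bar>)
                + (\<Sum>k=1..n. real (n - k) * \<epsilon> ^ 3 / (1 - real (n - k) * \<epsilon>\<^sup>2) * \<bar>x k\<bar>)"
      unfolding \<gamma>\<epsilon> by (simp add: \<gamma>_def)
    have \<gamma>_mono: "\<gamma> (n - k) \<le> \<gamma> (n - 1)" if "k \<in> {1..n}" for k
      unfolding \<gamma>_def using that small [of "n - 1"] by (intro div_1_minus_mono) auto
    have BC: "?B \<le> ?C"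
      unfolding sum_distrib_left using \<gamma>_mono \<epsilon>0
      by (intro add_mono sum_mono mult_right_mono order_refl) auto
    thus "\<epsilon> * (\<Sum>k=1..n. \<bar>x k\<bar>)
                + (\<Sum>k=1..n. real (n - k) * \<epsilon>\<^sup>2 / (1 - real (n - k) * \<epsilon>\<^sup>2) * \<bar>x k\<bar>)
                + (\<Sum>k=1..n. real (n - k) * \<epsilon> ^ 3 / (1 - real (n - k) * \<epsilon>\<^sup>2) * \<bar>x k\<bar>)
              \<le> \<epsilon> * (\<Sum>k=1..n. \<bar>x k\<bar>)
                + real (n - 1) * \<epsilon>\<^sup>2 / (1 - real (n - 1) * \<epsilon>\<^sup>2) * (\<Sum>k=1..n. \<bar>x k\<bar>)
                + real (n - 1) * \<epsilon> ^ 3 / (1 - real (n - 1) * \<epsilon>\<^sup>2) * (\<Sum>k=1..n. \<bar>x k\<bar>)"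
      unfolding \<gamma>\<epsilon> by (simp only: \<gamma>_def)
    have n: "n \<in> {1..n}" using assms(5) by simp
    \<comment> \<open>Exactness turns the rounding error of the last addition into a relative
      perturbation of \<open>s n + e n\<close>, so the bound for \<open>s n + e n\<close> transfers
      with a factor of at most \<open>1 + \<epsilon>\<close>.\<close>
    have "s n = (1 + \<beta> n) * (s n + e n)" using exact [OF n] \<beta>(2) [OF n] by simp
    hence "s n - stilde = (1 + \<beta> n) * (s n + e n - stilde) + \<beta> n * stilde"
      by (simp add: algebra_simps)
    also have "\<bar>\<dots>\<bar> \<le> \<bar>1 + \<beta> n\<bar> * \<bar>s n + e n - stilde\<bar> + \<bar>\<beta> n\<bar> * \<bar>stilde\<bar>"
      unfolding abs_mult [symmetric] by (rule abs_triangle_ineq)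
    also have "\<dots> \<le> (1 + \<epsilon>) * ?C + \<epsilon> * \<bar>stilde\<bar>"
      using \<beta>(1) [OF n] \<epsilon>0 order_trans [OF B BC] by (intro add_mono mult_mono) auto
    finally show "\<bar>s n - stilde\<bar>
              \<le> (1 + \<epsilon>) *
                  (\<epsilon> * (\<Sum>k=1..n. \<bar>x k\<bar>)
                   + real (n - 1) * \<epsilon>\<^sup>2 / (1 - real (n - 1) * \<epsilon>\<^sup>2) * (\<Sum>k=1..n. \<bar>x k\<bar>)
                   + real (n - 1) * \<epsilon> ^ 3 / (1 - real (n - 1) * \<epsilon>\<^sup>2) * (\<Sum>k=1..n. \<bar>x k\<bar>))
                + \<epsilon> * \<bar>\<Sum>k=1..n. x k\<bar>"
      unfolding \<gamma>\<epsilon> by (simp only: \<gamma>_def assms(7))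
  qed
qed

end
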